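(* Let $\mathcal{H}_n$ be an $n$-dimensional Hilbert space, let $K$ be a linear operator on $\mathcal{H}_n$, let $F=\{f_i\}_{i\in I_m}$ be a $K$-frame of $\mathcal{H}_n$ and let $G=\{g_i\}_{i\in I_m}$ be a $K$-dual of $F$. If there exists an $m\times m$ matrix $M_{F,G}$ satisfying $(M_{F,G}-\mathcal{G}_F)G^{*}=0$, then $G$ satisfies MRC for $(\operatorname{spark}(M_{F,G}-\mathcal{G}_F)-1)$-erasures.
   Context: $I_m=\{1,\dots,m\}$; $\mathcal{H}_n$ is identified with $\mathbb{C}^n$ via an orthonormal basis; inner products are linear in the first variable. A sequence is identified with the matrix having its vectors as columns, so $F,G$ are also $n\times m$ matrices, $G^{*}$ is the matrix of $f\mapsto\{\langle f,g_i\rangle\}_i$, and $\mathcal{G}_F=F^{*}F$ is the Gramian matrix. For an operator $L$ on $\mathcal{H}_n$, a sequence is an $L$-frame if the range of $L$ is contained in the span of the sequence. $G$ is a $K$-dual of $F$ if $FG^{*}$ is the matrix of $K$, i.e. $Kf=\sum_i\langle f,g_i\rangle f_i$ for all $f\in\mathcal{H}_n$; a $K$-dual of $F$ is a $K^{*}$-frame, and the minimal redundancy condition for $G$ is understood for $G$ as a $K^{*}$-frame: $G$ satisfies MRC for $\rho$-erasures if for every $\sigma\subset I_m$ with $|\sigma|=\rho$, $\{g_i\}_{i\in I_m\setminus\sigma}$ is a $K^{*}$-frame for $\mathcal{H}_n$. The spark of a matrix is the size of the smallest linearly dependent subset of its columns ($+\infty$ if the columns are linearly independent). *)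

theory Defs
  imports "HOL-Analysis.Analysis" "HOL-Library.Extended_Nat"
begin

text \<open>
  The Hilbert space of dimension \<open>CARD('n)\<close> is \<^typ>\<open>complex ^ 'n\<close>. The inner product of the
  library on this type is the real one, so the complex one is introduced here. Complex linearity,
  span and independence are those of the vector space over \<open>(*s)\<close>, that is
  \<open>Vector_Spaces.linear (*s) (*s)\<close>, \<open>vec.span\<close> and \<open>vec.independent\<close>; a sequence indexed by
  \<open>I\<^sub>m\<close> is a function on a finite index type with \<open>m = CARD('m)\<close>.
\<close>

definition cinner :: "complex ^ 'n \<Rightarrow> complex ^ 'n \<Rightarrow> complex" where
  "cinner x y = (\<Sum>i\<in>UNIV. x $ i * cnj (y $ i))"

definition ctranspose :: "complex ^ 'a ^ 'b \<Rightarrow> complex ^ 'b ^ 'a" where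
  "ctranspose A = (\<chi> i j. cnj (A $ j $ i))"

text \<open>The operator \<open>K\<^sup>*\<close>; see \<open>cinner_cadjoint\<close> and \<open>cadjoint_unique\<close>.\<close>

definition cadjoint :: "(complex ^ 'n \<Rightarrow> complex ^ 'n) \<Rightarrow> complex ^ 'n \<Rightarrow> complex ^ 'n" where
  "cadjoint K = (THE L. \<forall>x y. cinner (K x) y = cinner x (L y))"

definition seq_matrix :: "('m \<Rightarrow> complex ^ 'n) \<Rightarrow> complex ^ 'm ^ 'n" where
  "seq_matrix F = (\<chi> k i. F i $ k)"

definition gramian :: "('m \<Rightarrow> complex ^ 'n) \<Rightarrow> complex ^ 'm ^ 'm" where
  "gramian F = ctranspose (seq_matrix F) ** seq_matrix F"

text \<open>The subsequence \<open>(g\<^sub>i)\<close>, \<open>i \<in> J\<close>, is an \<open>L\<close>-frame.\<close>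

definition frame_on ::
  "'m set \<Rightarrow> (complex ^ 'n \<Rightarrow> complex ^ 'n) \<Rightarrow> ('m \<Rightarrow> complex ^ 'n) \<Rightarrow> bool" where
  "frame_on J L g \<longleftrightarrow> range L \<subseteq> vec.span (g ` J)"

definition K_dual ::
  "(complex ^ 'n \<Rightarrow> complex ^ 'n) \<Rightarrow> ('m::finite \<Rightarrow> complex ^ 'n) \<Rightarrow> ('m \<Rightarrow> complex ^ 'n) \<Rightarrow> bool" where
  "K_dual K F G \<longleftrightarrow> (\<forall>f. K f = (\<Sum>i\<in>UNIV. cinner f (G i) *s F i))"

text \<open>
  The minimal redundancy condition of \<open>G\<close> as an \<open>L\<close>-frame. The number of erasures is extended
  because the spark can be infinite; the condition is then vacuous.
\<close>

definition MRC ::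
  "(complex ^ 'n \<Rightarrow> complex ^ 'n) \<Rightarrow> ('m::finite \<Rightarrow> complex ^ 'n) \<Rightarrow> enat \<Rightarrow> bool" where
  "MRC L G \<rho> \<longleftrightarrow> (\<forall>\<sigma>. enat (card \<sigma>) = \<rho> \<longrightarrow> frame_on (UNIV - \<sigma>) L G)"

text \<open>
  Columns are counted by index, so two equal columns in different positions are dependent; this is
  the reason for the injectivity condition. The infimum of the empty set is \<^term>\<open>\<infinity> :: enat\<close>.
\<close>

definition columns_dependent :: "complex ^ 'm ^ 'k \<Rightarrow> 'm set \<Rightarrow> bool" where
  "columns_dependent A S \<longleftrightarrow>
     \<not> (inj_on (\<lambda>j. column j A) S \<and> vec.independent ((\<lambda>j. column j A) ` S))"

definition spark :: "complex ^ 'm::finite ^ 'k \<Rightarrow> enat" where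
  "spark A = Inf {enat (card S) | S. columns_dependent A S}"

lemma cinner_ctranspose: "cinner (A *v x) y = cinner x (ctranspose A *v y)"
proof -
  have "cinner (A *v x) y = (\<Sum>i\<in>UNIV. \<Sum>j\<in>UNIV. A $ i $ j * x $ j * cnj (y $ i))"
    by (simp add: cinner_def matrix_vector_mult_def sum_distrib_right)
  also have "\<dots> = (\<Sum>j\<in>UNIV. \<Sum>i\<in>UNIV. A $ i $ j * x $ j * cnj (y $ i))"
    by (rule sum.swap)
  also have "\<dots> = cinner x (ctranspose A *v y)"
    by (simp add: cinner_def ctranspose_def matrix_vector_mult_def sum_distrib_left mult_ac)
  finally show ?thesis .
qed

lemma cinner_axis: "cinner (axis i 1) y = cnj (y $ i)"
  unfolding cinner_def axis_def by (simp add: if_distrib[of "\<lambda>a. a * _"] cong: if_cong)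

lemma cadjoint_unique:
  assumes "\<And>x y. cinner (K x) y = cinner x (L y)"
  shows "cadjoint K = L"
  unfolding cadjoint_def
proof (rule the_equality)
  show "\<forall>x y. cinner (K x) y = cinner x (L y)"
    using assms by blast
next
  fix L' assume L': "\<forall>x y. cinner (K x) y = cinner x (L' y)"
  have "cnj (L' y $ i) = cnj (L y $ i)" for y i
    by (simp only: cinner_axis[symmetric] L'[rule_format, symmetric] assms[symmetric])
  then show "L' = L"
    by (simp add: fun_eq_iff vec_eq_iff)
qed

lemma cadjoint_eq_ctranspose:
  assumes "Vector_Spaces.linear (*s) (*s) K"
  shows "cadjoint K = (\<lambda>y. ctranspose (matrix K) *v y)"
  by (rule cadjoint_unique)
     (simp add: cinner_ctranspose[symmetric] matrix_works[OF assms])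

lemma cinner_cadjoint:
  assumes "Vector_Spaces.linear (*s) (*s) K"
  shows "cinner (K x) y = cinner x (cadjoint K y)"
  by (simp add: cadjoint_eq_ctranspose[OF assms] cinner_ctranspose[symmetric] matrix_works[OF assms])

lemma K_dual_iff_matrix:
  assumes "Vector_Spaces.linear (*s) (*s) K"
  shows "K_dual K F G \<longleftrightarrow> seq_matrix F ** ctranspose (seq_matrix G) = matrix K"
proof -
  have "(seq_matrix F ** ctranspose (seq_matrix G)) *v f = (\<Sum>i\<in>UNIV. cinner f (G i) *s F i)" for f
    by (simp add: matrix_vector_mul_assoc[symmetric] vec_eq_iff)
       (simp add: matrix_vector_mult_def seq_matrix_def ctranspose_def cinner_def mult_ac)
  then show ?thesis
    unfolding K_dual_def matrix_eq matrix_works[OF assms] by auto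
qed

end

theory Submission imports Defs begin

text \<open>
  Put \<open>A = M - \<G>\<^sub>F\<close>. The relation \<open>A G\<^sup>* = 0\<close> is, after conjugation, a family of linear
  relations among the \<open>g\<^sub>i\<close>, one for each row of \<open>A\<close>. If the columns of \<open>A\<close> in \<open>\<sigma>\<close> are independent,
  composing \<open>A\<close> with a linear map that sends them to the standard basis vectors solves these
  relations for the \<open>g\<^sub>i\<close> with \<open>i \<in> \<sigma>\<close>. So erasing \<open>\<sigma>\<close> does not change the span of \<open>G\<close>, which
  contains the range of \<open>K\<^sup>*\<close>.
\<close>

lemma columns_independent_if_card_eq_spark_minus_1:
  fixes A :: "complex ^ 'm::finite ^ 'k"
  assumes "enat (card S) = spark A - 1"
  shows "\<not> columns_dependent A S"
proof
  assume dep: "columns_dependent A S"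
  then have "spark A \<le> enat (card S)"
    unfolding spark_def by (auto intro!: Inf_lower)
  \<comment> \<open>Subtraction on \<open>enat\<close> is truncated, so
    \<open>spark A \<le> spark A - 1\<close> is still possible when \<open>spark A = 0\<close>. An
    infinite spark is excluded because \<open>card S\<close> is finite.\<close>
  then have "card S = 0"
    using assms by (cases "spark A") (auto simp: one_enat_def)
  then show False
    using dep by (simp add: columns_dependent_def vec.independent_empty)
qed

text \<open>Moving the sum to the other side of the inner product exchanges \<open>F\<close> and
  \<open>G\<close>. This places the range of the adjoint in the span of \<open>G\<close>.\<close>

lemma cadjoint_K_dual:
  assumes "K_dual K F G"
  shows "cadjoint K y = (\<Sum>i\<in>UNIV. cinner y (F i) *s G i)"
proof -
  have "cinner (K x) y = cinner x (\<Sum>i\<in>UNIV. cinner y (F i) *s G i)" for x y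
  proof -
    have "cinner (K x) y = (\<Sum>k\<in>UNIV. \<Sum>i\<in>UNIV. cinner x (G i) * F i $ k * cnj (y $ k))"
      using assms by (simp add: K_dual_def cinner_def[of "sum _ _"] sum_distrib_right)
    also have "\<dots> = (\<Sum>i\<in>UNIV. cinner x (G i) * cnj (cinner y (F i)))"
      by (subst sum.swap) (simp add: cinner_def[of y] sum_distrib_left mult_ac)
    also have "\<dots> = (\<Sum>i\<in>UNIV. \<Sum>k\<in>UNIV. x $ k * cnj (G i $ k) * cnj (cinner y (F i)))"
      by (simp add: cinner_def[of x] sum_distrib_right)
    also have "\<dots> = cinner x (\<Sum>i\<in>UNIV. cinner y (F i) *s G i)"
      by (subst sum.swap) (simp add: cinner_def[of x] sum_distrib_left mult_ac)
    finally show ?thesis .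
  qed
  then have "cadjoint K = (\<lambda>y. \<Sum>i\<in>UNIV. cinner y (F i) *s G i)"
    by (rule cadjoint_unique)
  then show ?thesis by simp
qed

lemma span_erase_columns_independent:
  fixes G :: "'m::finite \<Rightarrow> complex ^ 'n" and A :: "complex ^ 'm ^ 'k"
  assumes AG: "A ** ctranspose (seq_matrix G) = 0"
    and indep: "\<not> columns_dependent A \<sigma>"
  shows "G i \<in> vec.span (G ` (UNIV - \<sigma>))"
proof (cases "i \<in> \<sigma>")
  case False
  then show ?thesis by (auto intro: vec.span_base)
next
  case True
  let ?c = "\<lambda>j. column j A"
  have inj: "inj_on ?c \<sigma>" and ind: "vec.independent (?c ` \<sigma>)"
    using indep by (auto simp: columns_dependent_def)
  \<comment> \<open>Injectivity on \<open>\<sigma>\<close> lets a column recover its index, so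
    distinct indices get distinct basis vectors. The values of \<open>L\<close> on the other columns
    do not matter: they only become coefficients.\<close>
  obtain L :: "complex ^ 'k \<Rightarrow> complex ^ 'm" where lin: "Vector_Spaces.linear (*s) (*s) L"
    and L: "\<And>v. v \<in> ?c ` \<sigma> \<Longrightarrow> L v = axis (inv_into \<sigma> ?c v) 1"
    using vec.linear_independent_extend[OF ind, of "\<lambda>v. axis (inv_into \<sigma> ?c v) 1"] by blast
  interpret L: Vector_Spaces.linear "(*s)" "(*s)" L by (rule lin)
  have Lc: "L (?c j) $ i = (if j = i then 1 else 0)" if "j \<in> \<sigma>" for j
    using L[of "?c j"] inv_into_f_f[OF inj that] that by (auto simp: axis_def)
  \<comment> \<open>Column \<open>k\<close> of the zero product is a vanishing combination of the
    columns of \<open>A\<close>; apply \<open>L\<close> and read off coordinate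
    \<open>i\<close>.\<close>
  have rel: "(\<Sum>j\<in>UNIV. cnj (G j $ k) * L (?c j) $ i) = 0" for k
  proof -
    have "(\<Sum>j\<in>UNIV. cnj (G j $ k) *s ?c j) = 0"
      using AG by (simp add: vec_eq_iff matrix_matrix_mult_def column_def ctranspose_def
          seq_matrix_def mult.commute)
    then have "L (\<Sum>j\<in>UNIV. cnj (G j $ k) *s ?c j) $ i = 0"
      by (simp add: L.zero)
    then show ?thesis
      by (simp add: L.sum L.scale)
  qed
  \<comment> \<open>In \<open>rel\<close>, \<open>G i\<close> is the only erased vector that
    survives. The coefficients of the others are independent of \<open>k\<close>, so the
    coordinatewise identities, once conjugated, form one vector identity.\<close>
  have "G i = (\<Sum>j\<in>UNIV - \<sigma>. - cnj (L (?c j) $ i) *s G j)"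
  proof (subst vec_eq_iff, rule allI)
    fix k
    have "0 = (\<Sum>j\<in>UNIV - \<sigma>. cnj (G j $ k) * L (?c j) $ i) + (\<Sum>j\<in>\<sigma>. cnj (G j $ k) * L (?c j) $ i)"
      using rel[of k] by (simp add: sum.subset_diff[of \<sigma> UNIV])
    also have "(\<Sum>j\<in>\<sigma>. cnj (G j $ k) * L (?c j) $ i) = cnj (G i $ k)"
      using True by (simp add: Lc if_distrib[of "\<lambda>a. _ * a"] cong: if_cong)
    finally have "cnj (G i $ k) = - (\<Sum>j\<in>UNIV - \<sigma>. cnj (G j $ k) * L (?c j) $ i)"
      by (simp add: eq_neg_iff_add_eq_0 add.commute)
    then have "cnj (cnj (G i $ k)) = cnj (- (\<Sum>j\<in>UNIV - \<sigma>. cnj (G j $ k) * L (?c j) $ i))"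
      by (rule arg_cong)
    then show "G i $ k = (\<Sum>j\<in>UNIV - \<sigma>. - cnj (L (?c j) $ i) *s G j) $ k"
      by (simp add: sum_negf mult.commute)
  qed
  also have "\<dots> \<in> vec.span (G ` (UNIV - \<sigma>))"
    by (intro vec.span_sum vec.span_scale vec.span_base) auto
  finally show ?thesis .
qed

theorem theorem5p7:
  fixes K :: "complex ^ 'n \<Rightarrow> complex ^ 'n"
    and F G :: "'m::finite \<Rightarrow> complex ^ 'n"
    and M :: "complex ^ 'm ^ 'm"
  assumes "Vector_Spaces.linear (*s) (*s) K"
    and "frame_on UNIV K F"
    and "K_dual K F G"
    and "(M - gramian F) ** ctranspose (seq_matrix G) = 0"
  shows "MRC (cadjoint K) G (spark (M - gramian F) - 1)"
  unfolding MRC_def frame_on_def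
proof (intro allI impI subsetI)
  fix \<sigma> :: "'m set" and x
  assume \<sigma>: "enat (card \<sigma>) = spark (M - gramian F) - 1" and "x \<in> range (cadjoint K)"
  then obtain y where "x = (\<Sum>i\<in>UNIV. cinner y (F i) *s G i)"
    using cadjoint_K_dual[OF assms(3)] by auto
  \<comment> \<open>Erased or not, every \<open>G i\<close> lies in the span of the remaining
    vectors, hence so does the whole sum.\<close>
  then show "x \<in> vec.span (G ` (UNIV - \<sigma>))"
    using span_erase_columns_independent[OF assms(4)
        columns_independent_if_card_eq_spark_minus_1[OF \<sigma>]]
    by (auto intro!: vec.span_sum vec.span_scale)
qed

end
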